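(* Let $0<\varphi\le\frac{\pi}{2}$, $c=\cos\varphi$, $s=\sin\varphi=\sqrt{1-c^2}$. The optimal outer cubic $G^0$ approximant of the circular arc $\alpha\mapsto(\cos\alpha,\sin\alpha)^T$, $\alpha\in[-\varphi,\varphi]$, is given by the pair of parameters $$\xi^\land=\frac{4-c}{3},\qquad \eta^\land=\frac{3-4c+c^2}{3\sqrt{1-c^2}},$$ and it is a $G^1$ approximant.
   Context: For real $\xi>0$ and $\eta\in\mathbb{R}$, the cubic $G^0$ approximant with parameters $(\xi,\eta)$ is the curve $p:[-1,1]\to\mathbb{R}^2$, $p(t)=\sum_{i=0}^3\binom{3}{i}\left(\frac{1+t}{2}\right)^i\left(\frac{1-t}{2}\right)^{3-i}b_i$, with control points $b_0=(c,-s)$, $b_1=(\xi,-\eta)$, $b_2=(\xi,\eta)$, $b_3=(c,s)$. Its simplified radial error function is $\psi(t,\xi,\eta)=\|p(t)\|_2^2-1$. The approximant is outer if $\psi(t,\xi,\eta)\ge0$ for all $t\in[-1,1]$. An outer approximant is optimal if it minimizes $\max_{t\in[-1,1]}|\psi(t,\xi,\eta)|$ among all outer approximants of this form (all $\xi>0$, $\eta\in\mathbb{R}$ giving an outer approximant). It is a $G^1$ approximant if it also interpolates the tangent directions of the arc at the two boundary points, i.e. $b_1-b_0$ is a positive multiple of $(s,c)$ and $b_3-b_2$ is a positive multiple of $(-s,c)$. *)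

theory Defs
  imports "HOL-Analysis.Analysis"
begin

definition control_point :: "real \<Rightarrow> real \<Rightarrow> real \<Rightarrow> nat \<Rightarrow> real^2" where
  "control_point \<phi> \<xi> \<eta> i =
     [vector [cos \<phi>, - sin \<phi>], vector [\<xi>, - \<eta>], vector [\<xi>, \<eta>], vector [cos \<phi>, sin \<phi>]] ! i"

definition cubic_curve :: "real \<Rightarrow> real \<Rightarrow> real \<Rightarrow> real \<Rightarrow> real^2" where
  "cubic_curve \<phi> \<xi> \<eta> t =
     (\<Sum>i=0..3. (real (3 choose i) * ((1 + t) / 2) ^ i * ((1 - t) / 2) ^ (3 - i))
                *\<^sub>R control_point \<phi> \<xi> \<eta> i)"

definition radial_error :: "real \<Rightarrow> real \<Rightarrow> real \<Rightarrow> real \<Rightarrow> real" where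
  "radial_error \<phi> \<xi> \<eta> t = (norm (cubic_curve \<phi> \<xi> \<eta> t))\<^sup>2 - 1"

text \<open>The parameters of a cubic \<open>G\<^sup>0\<close> approximant of the arc of half-angle \<open>\<phi>\<close> are required
  to satisfy \<open>\<xi> > 0\<close>; the interpolation of the end points of the arc is built into the control
  points.\<close>

definition outer_approximant :: "real \<Rightarrow> real \<Rightarrow> real \<Rightarrow> bool" where
  "outer_approximant \<phi> \<xi> \<eta> \<longleftrightarrow> \<xi> > 0 \<and> (\<forall>t\<in>{-1..1}. radial_error \<phi> \<xi> \<eta> t \<ge> 0)"

definition max_error :: "real \<Rightarrow> real \<Rightarrow> real \<Rightarrow> real" where
  "max_error \<phi> \<xi> \<eta> = (SUP t\<in>{-1..1}. \<bar>radial_error \<phi> \<xi> \<eta> t\<bar>)"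

text \<open>The supremum is a genuine maximum.\<close>

lemma max_error_attained:
  "(\<exists>t\<in>{-1..1}. \<bar>radial_error \<phi> \<xi> \<eta> t\<bar> = max_error \<phi> \<xi> \<eta>) \<and>
   (\<forall>t\<in>{-1..1}. \<bar>radial_error \<phi> \<xi> \<eta> t\<bar> \<le> max_error \<phi> \<xi> \<eta>)"
proof -
  let ?f = "\<lambda>t. \<bar>radial_error \<phi> \<xi> \<eta> t\<bar>"
  have "continuous_on {-1..1} ?f"
    unfolding radial_error_def cubic_curve_def by (intro continuous_intros) auto
  then obtain t where t: "t \<in> {-1..1}" "\<forall>u\<in>{-1..1}. ?f u \<le> ?f t"
    using continuous_attains_sup[of "{-1..1::real}" ?f] by auto
  then have "max_error \<phi> \<xi> \<eta> = ?f t"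
    unfolding max_error_def by (intro cSup_eq_maximum) auto
  then show ?thesis using t by auto
qed

definition optimal_outer_approximant :: "real \<Rightarrow> real \<Rightarrow> real \<Rightarrow> bool" where
  "optimal_outer_approximant \<phi> \<xi> \<eta> \<longleftrightarrow>
     outer_approximant \<phi> \<xi> \<eta> \<and>
     (\<forall>\<xi>' \<eta>'. outer_approximant \<phi> \<xi>' \<eta>' \<longrightarrow> max_error \<phi> \<xi> \<eta> \<le> max_error \<phi> \<xi>' \<eta>')"

definition G1_approximant :: "real \<Rightarrow> real \<Rightarrow> real \<Rightarrow> bool" where
  "G1_approximant \<phi> \<xi> \<eta> \<longleftrightarrow> \<xi> > 0 \<and>
     (\<exists>r>0. control_point \<phi> \<xi> \<eta> 1 - control_point \<phi> \<xi> \<eta> 0 = r *\<^sub>R vector [sin \<phi>, cos \<phi>]) \<and>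
     (\<exists>r>0. control_point \<phi> \<xi> \<eta> 3 - control_point \<phi> \<xi> \<eta> 2 = r *\<^sub>R vector [- sin \<phi>, cos \<phi>])"

end

(* In the variables u = (1 - t^2)/4, X = 3(xi - c), Y = 3 eta - s the error is
     psi = (c + u X)^2 + (1 - 4u)(s + u Y)^2 - 1,   0 <= u <= 1/4.
   Nonnegativity at u = 1/4 forces X >= 4(1 - c); nonnegativity of the derivative at u = 0
   forces c X + s Y >= 2 s^2. The claimed parameters are the vertex (X0, Y0) of this wedge, for
   which psi = Y0^2 u^2 (1 - 4u), with maximum at u = 1/6. At that u, psi is a strictly convex
   quadratic in (X, Y), and its gradient at the vertex lies in the cone spanned by the normals
   of the two constraints; hence over the wedge psi(u = 1/6) is minimal exactly at the vertex. *)

theory Submission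
  imports Defs
begin

text \<open>The Bernstein sums collapse by parity: the first coordinate is \<open>c + u X\<close>,
  even in \<open>t\<close>, and the second is \<open>t\<close> times \<open>s + u Y\<close>. As
  \<open>t\<^sup>2 = 1 - 4 * u\<close>, the error depends on \<open>t\<close> only through
  \<open>u\<close>.\<close>

lemma radial_error_eq:
  fixes \<phi> \<xi> \<eta> t :: real
  defines "u \<equiv> (1 - t\<^sup>2) / 4"
  shows "radial_error \<phi> \<xi> \<eta> t =
    (cos \<phi> + u * (3 * (\<xi> - cos \<phi>)))\<^sup>2 + (1 - 4 * u) * (sin \<phi> + u * (3 * \<eta> - sin \<phi>))\<^sup>2 - 1"
proof -
  have x: "cubic_curve \<phi> \<xi> \<eta> t $ 1 = cos \<phi> + u * (3 * (\<xi> - cos \<phi>))"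
    unfolding cubic_curve_def control_point_def u_def
    by (simp add: eval_nat_numeral sum.atLeast0_atMost_Suc) (simp add: field_simps)
  have y: "cubic_curve \<phi> \<xi> \<eta> t $ 2 = t * (sin \<phi> + u * (3 * \<eta> - sin \<phi>))"
    unfolding cubic_curve_def control_point_def u_def
    by (simp add: eval_nat_numeral sum.atLeast0_atMost_Suc) (simp add: field_simps)
  have "(norm (cubic_curve \<phi> \<xi> \<eta> t))\<^sup>2
      = (cubic_curve \<phi> \<xi> \<eta> t $ 1)\<^sup>2 + (cubic_curve \<phi> \<xi> \<eta> t $ 2)\<^sup>2"
    by (simp only: power2_norm_eq_inner inner_vec_def sum_2) (simp add: power2_eq_square)
  moreover have "t\<^sup>2 = 1 - 4 * u"
    by (simp add: u_def field_simps)
  ultimately show ?thesis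
    unfolding radial_error_def x y by (simp add: power_mult_distrib)
qed

lemma radial_error_sqrt:
  fixes u :: real
  assumes "u \<le> 1 / 4"
  shows "radial_error \<phi> \<xi> \<eta> (sqrt (1 - 4 * u)) =
    (cos \<phi> + u * (3 * (\<xi> - cos \<phi>)))\<^sup>2 + (1 - 4 * u) * (sin \<phi> + u * (3 * \<eta> - sin \<phi>))\<^sup>2 - 1"
  using assms by (simp add: radial_error_eq)

text \<open>Divide by \<open>u > 0\<close> and let \<open>u\<close> tend to 0 from the right. This
  replaces a derivative test at the end point.\<close>

lemma linear_coeff_nonneg:
  fixes a b d e :: real
  assumes "e > 0" and nonneg: "\<And>u. 0 < u \<Longrightarrow> u \<le> e \<Longrightarrow> 0 \<le> a * u + b * u\<^sup>2 + d * u ^ 3"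
  shows "a \<ge> 0"
proof -
  have "((\<lambda>u. a + b * u + d * u\<^sup>2) \<longlongrightarrow> a + b * 0 + d * 0\<^sup>2) (at_right 0)"
    by (intro tendsto_intros)
  moreover have "\<forall>\<^sub>F u in at_right 0. 0 \<le> a + b * u + d * u\<^sup>2"
    unfolding eventually_at_right_field
  proof (intro exI[of _ e] conjI allI impI)
    fix u :: real
    assume u: "0 < u" "u < e"
    have "a * u + b * u\<^sup>2 + d * u ^ 3 = u * (a + b * u + d * u\<^sup>2)"
      by (simp add: algebra_simps power2_eq_square power3_eq_cube)
    with nonneg[of u] u show "0 \<le> a + b * u + d * u\<^sup>2"
      by (simp add: zero_le_mult_iff)
  qed (use \<open>e > 0\<close> in simp)
  ultimately show ?thesis
    using tendsto_lowerbound[of "\<lambda>u. a + b * u + d * u\<^sup>2" a "at_right 0" 0] by simp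
qed

text \<open>At \<open>t = 0\<close> the curve meets the first axis, so its abscissa
  \<open>(cos \<phi> + 3 * \<xi>) / 4\<close> has square at least 1. Positivity of \<xi> rules out
  the negative branch.\<close>

lemma outer_approximant_midpoint:
  assumes "outer_approximant \<phi> \<xi> \<eta>" and "cos \<phi> \<ge> 0"
  shows "3 * (\<xi> - cos \<phi>) \<ge> 4 * (1 - cos \<phi>)"
proof -
  have "\<xi> > 0" and "radial_error \<phi> \<xi> \<eta> 0 \<ge> 0"
    using assms(1) by (auto simp: outer_approximant_def)
  then have "1\<^sup>2 \<le> (cos \<phi> + 1 / 4 * (3 * (\<xi> - cos \<phi>)))\<^sup>2"
    by (simp add: radial_error_eq)
  moreover have "0 \<le> cos \<phi> + 1 / 4 * (3 * (\<xi> - cos \<phi>))"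
    using \<open>\<xi> > 0\<close> assms(2) by (simp add: field_simps)
  ultimately have "1 \<le> cos \<phi> + 1 / 4 * (3 * (\<xi> - cos \<phi>))"
    by (rule power2_le_imp_le)
  then show ?thesis by (simp add: field_simps)
qed

text \<open>The error vanishes at \<open>u = 0\<close> because the end points lie on the circle, so
  its linear coefficient in \<open>u\<close> must be nonnegative.\<close>

lemma outer_approximant_endpoint:
  assumes "outer_approximant \<phi> \<xi> \<eta>"
  shows "cos \<phi> * (3 * (\<xi> - cos \<phi>)) + sin \<phi> * (3 * \<eta> - sin \<phi>) \<ge> 2 * (sin \<phi>)\<^sup>2"
proof -
  define c s X Y where "c = cos \<phi>" and "s = sin \<phi>" and "X = 3 * (\<xi> - c)" and "Y = 3 * \<eta> - s"
  have cs: "c\<^sup>2 + s\<^sup>2 = 1"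
    by (simp add: c_def s_def)
  have "2 * (c * X + s * Y - 2 * s\<^sup>2) \<ge> 0"
  proof (rule linear_coeff_nonneg[of "1/4"])
    fix u :: real
    assume u: "0 < u" "u \<le> 1/4"
    have "sqrt (1 - 4 * u) \<le> 1"
      using u by simp
    moreover have "sqrt (1 - 4 * u) \<ge> -1"
      using u by (intro order_trans[OF _ real_sqrt_ge_zero]) auto
    ultimately have "radial_error \<phi> \<xi> \<eta> (sqrt (1 - 4 * u)) \<ge> 0"
      using assms by (simp add: outer_approximant_def)
    then have "0 \<le> (c + u * X)\<^sup>2 + (1 - 4 * u) * (s + u * Y)\<^sup>2 - (c\<^sup>2 + s\<^sup>2)"
      using u by (simp add: radial_error_sqrt cs c_def s_def X_def Y_def)
    also have "\<dots> = 2 * (c * X + s * Y - 2 * s\<^sup>2) * u + (X\<^sup>2 + Y\<^sup>2 - 8 * s * Y) * u\<^sup>2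
        + (- 4 * Y\<^sup>2) * u ^ 3"
      by algebra
    finally show "0 \<le> 2 * (c * X + s * Y - 2 * s\<^sup>2) * u + (X\<^sup>2 + Y\<^sup>2 - 8 * s * Y) * u\<^sup>2
        + (- 4 * Y\<^sup>2) * u ^ 3" .
  qed simp
  then show ?thesis
    by (simp add: c_def s_def X_def Y_def)
qed

text \<open>This is a Karush-Kuhn-Tucker argument for the error at \<open>u = 1/6\<close>. The bound
  in the last hypothesis is the value at the vertex.\<close>

lemma vertex_unique_minimizer:
  fixes c s X Y Y0 :: real
  assumes cs: "c\<^sup>2 + s\<^sup>2 = 1" and "0 \<le> c" "c \<le> 1" "0 < s"
    and Y0: "s * Y0 = 2 * (1 - c)\<^sup>2"
    and X: "X \<ge> 4 * (1 - c)" and XY: "c * X + s * Y \<ge> 2 * s\<^sup>2"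
    and le: "(c + X / 6)\<^sup>2 + (s + Y / 6)\<^sup>2 / 3 - 1 \<le> Y0\<^sup>2 / 108"
  shows "X = 4 * (1 - c) \<and> Y = Y0"
proof -
  \<comment> \<open>At the vertex, three times the gradient in \<open>(X, Y)\<close> is
    \<open>((2 + c) / 3, (s + Y0 / 6) / 3)\<close>. It equals
    \<open>\<kappa> (1, 0) + \<mu> (c, s)\<close>, so \<kappa> and \<mu> are the multipliers of the
    two constraints.\<close>
  define \<mu> where "\<mu> = (s + Y0 / 6) / (3 * s)"
  define \<kappa> where "\<kappa> = (2 + c) / 3 - c * \<mu>"
  define dX dY where "dX = X - 4 * (1 - c)" and "dY = Y - Y0"
  have \<mu>: "3 * s * \<mu> = s + Y0 / 6"
    using \<open>0 < s\<close> by (simp add: \<mu>_def)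
  have "0 \<le> s * Y0"
    by (simp add: Y0)
  then have "0 \<le> Y0"
    using \<open>0 < s\<close> by (simp add: zero_le_mult_iff)
  then have "0 \<le> \<mu>"
    using \<open>0 < s\<close> by (simp add: \<mu>_def)
  \<comment> \<open>The bound \<open>Y0 \<le> 2 * s\<close> gives \<open>\<mu> \<le> 4 / 9\<close>,
    whence \<open>\<kappa> \<ge> 2 / 3 - c / 9 \<ge> 0\<close>.\<close>
  have "2 * s\<^sup>2 - s * Y0 = 4 * c * (1 - c)"
    using cs Y0 by algebra
  moreover have "0 \<le> 4 * c * (1 - c)"
    using \<open>0 \<le> c\<close> \<open>c \<le> 1\<close> by simp
  ultimately have "s * Y0 \<le> s * (2 * s)"
    by (simp add: power2_eq_square)
  then have "Y0 \<le> 2 * s"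
    using \<open>0 < s\<close> by simp
  then have "\<mu> \<le> 4 / 9"
    using \<open>0 < s\<close> by (simp add: \<mu>_def field_simps)
  then have "c * \<mu> \<le> c * (4 / 9)"
    using \<open>0 \<le> c\<close> by (intro mult_left_mono)
  then have "0 \<le> \<kappa>"
    using \<open>0 \<le> c\<close> \<open>c \<le> 1\<close> by (simp add: \<kappa>_def)
  have "0 \<le> dX"
    using X by (simp add: dX_def)
  have "c * dX + s * dY = c * X + s * Y - 2 * s\<^sup>2"
    using cs Y0 unfolding dX_def dY_def by algebra
  then have "0 \<le> c * dX + s * dY"
    using XY by simp
  have vertex: "((2 + c) / 3)\<^sup>2 + (s + Y0 / 6)\<^sup>2 / 3 - 1 = Y0\<^sup>2 / 108"
  proof -
    have "108 * (((2 + c) / 3)\<^sup>2 + (s + Y0 / 6)\<^sup>2 / 3 - 1)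
        = 12 * (2 + c)\<^sup>2 + 36 * s\<^sup>2 + 12 * (s * Y0) + Y0\<^sup>2 - 108"
      by (simp add: power2_eq_square field_simps)
    also have "\<dots> = Y0\<^sup>2"
      using cs Y0 by algebra
    finally show ?thesis by simp
  qed
  \<comment> \<open>The second-order Taylor expansion at the vertex is exact, the error being
    quadratic in \<open>(X, Y)\<close>. All terms beyond the vertex value are nonnegative, and the
    pure squares force \<open>dX = dY = 0\<close>.\<close>
  have "(c + X / 6)\<^sup>2 + (s + Y / 6)\<^sup>2 / 3 - 1
      = (((2 + c) / 3)\<^sup>2 + (s + Y0 / 6)\<^sup>2 / 3 - 1)
        + ((2 + c) / 3 * dX + (s + Y0 / 6) * dY / 3) / 3 + dX\<^sup>2 / 36 + dY\<^sup>2 / 108"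
    by (simp add: dX_def dY_def power2_eq_square field_simps)
  also have "(2 + c) / 3 * dX + (s + Y0 / 6) * dY / 3 = \<kappa> * dX + \<mu> * (c * dX + s * dY)"
    by (simp add: \<kappa>_def \<mu>[symmetric] algebra_simps)
  finally have "(\<kappa> * dX + \<mu> * (c * dX + s * dY)) / 3 + dX\<^sup>2 / 36 + dY\<^sup>2 / 108 \<le> 0"
    using le vertex by linarith
  moreover have "0 \<le> \<kappa> * dX" "0 \<le> \<mu> * (c * dX + s * dY)"
    using \<open>0 \<le> \<kappa>\<close> \<open>0 \<le> dX\<close> \<open>0 \<le> \<mu>\<close> \<open>0 \<le> c * dX + s * dY\<close> by simp_all
  moreover have "0 \<le> dX\<^sup>2" "0 \<le> dY\<^sup>2"
    by simp_all
  ultimately have "dX\<^sup>2 \<le> 0 \<and> dY\<^sup>2 \<le> 0"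
    by argo
  then show ?thesis
    by (simp add: dX_def dY_def)
qed

text \<open>Both constraints are active here, so this cubic in \<open>u\<close> has a double zero at
  0 and a zero at \<open>1/4\<close>; only its leading coefficient remains.\<close>

lemma radial_error_vertex:
  fixes \<phi> \<xi> \<eta> t :: real
  defines "u \<equiv> (1 - t\<^sup>2) / 4"
  assumes X: "3 * (\<xi> - cos \<phi>) = 4 * (1 - cos \<phi>)"
    and Y: "sin \<phi> * (3 * \<eta> - sin \<phi>) = 2 * (1 - cos \<phi>)\<^sup>2"
  shows "radial_error \<phi> \<xi> \<eta> t = (3 * \<eta> - sin \<phi>)\<^sup>2 * (u\<^sup>2 * (1 - 4 * u))"
proof -
  define c s Y where "c = cos \<phi>" and "s = sin \<phi>" and "Y = 3 * \<eta> - sin \<phi>"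
  have "c\<^sup>2 + s\<^sup>2 = 1" and "s * Y = 2 * (1 - c)\<^sup>2"
    using Y by (simp_all add: c_def s_def Y_def)
  then have "(c + u * (4 * (1 - c)))\<^sup>2 + (1 - 4 * u) * (s + u * Y)\<^sup>2 - 1
      = Y\<^sup>2 * (u\<^sup>2 * (1 - 4 * u))"
    by algebra
  then show ?thesis
    by (simp only: radial_error_eq X u_def c_def s_def Y_def)
qed

text \<open>The gap to the maximum has a double root at the maximizer \<open>u = 1/6\<close>,
  leaving a linear factor positive for \<open>u \<ge> 0\<close>.\<close>

lemma square_mult_one_minus_le:
  fixes u :: real
  assumes "0 \<le> u"
  shows "u\<^sup>2 * (1 - 4 * u) \<le> 1 / 108"
proof -
  have "1 / 108 - u\<^sup>2 * (1 - 4 * u) = 4 * (u - 1 / 6)\<^sup>2 * (u + 1 / 12)"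
    by (simp add: power2_eq_square field_simps)
  moreover have "0 \<le> 4 * (u - 1 / 6)\<^sup>2 * (u + 1 / 12)"
    using assms by simp
  ultimately show ?thesis by linarith
qed

theorem mainTheorem7:
  fixes \<phi> c \<xi>_opt \<eta>_opt :: real
  assumes "0 < \<phi>" and "\<phi> \<le> pi / 2"
    and "c = cos \<phi>"
    and "\<xi>_opt = (4 - c) / 3"
    and "\<eta>_opt = (3 - 4 * c + c\<^sup>2) / (3 * sqrt (1 - c\<^sup>2))"
  shows "(\<forall>\<xi> \<eta>. optimal_outer_approximant \<phi> \<xi> \<eta> \<longleftrightarrow> \<xi> = \<xi>_opt \<and> \<eta> = \<eta>_opt)
         \<and> G1_approximant \<phi> \<xi>_opt \<eta>_opt"
proof -
  define s where "s = sin \<phi>"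
  define Y0 where "Y0 = 3 * \<eta>_opt - s"
  have "0 < s"
    unfolding s_def using assms(1,2) by (intro sin_gt_zero) auto
  have "0 \<le> c"
    unfolding assms(3) using assms(1,2) by (intro cos_ge_zero) auto
  have cs: "c\<^sup>2 + s\<^sup>2 = 1"
    by (simp add: assms(3) s_def)
  have "c < 1"
    using cos_monotone_0_pi[of 0 \<phi>] assms(1,2) by (simp add: assms(3))
  have "sqrt (1 - c\<^sup>2) = s"
    using cs \<open>0 < s\<close> by (intro real_sqrt_unique) auto
  then have \<eta>: "3 * s * \<eta>_opt = 3 - 4 * c + c\<^sup>2"
    using \<open>0 < s\<close> by (simp add: assms(5))
  have Y0: "s * Y0 = 2 * (1 - c)\<^sup>2"
    using \<eta> cs unfolding Y0_def by algebra
  have X0: "3 * (\<xi>_opt - c) = 4 * (1 - c)"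
    by (simp add: assms(4) field_simps)
  have error: "radial_error \<phi> \<xi>_opt \<eta>_opt t
      = Y0\<^sup>2 * (((1 - t\<^sup>2) / 4)\<^sup>2 * (1 - 4 * ((1 - t\<^sup>2) / 4)))" for t
    unfolding Y0_def s_def
    by (rule radial_error_vertex) (use X0 Y0 in \<open>simp_all add: assms(3) s_def Y0_def\<close>)
  have error_nonneg: "0 \<le> radial_error \<phi> \<xi>_opt \<eta>_opt t" for t
    by (simp add: error)
  have outer: "outer_approximant \<phi> \<xi>_opt \<eta>_opt"
    using error_nonneg \<open>c < 1\<close> by (simp add: outer_approximant_def assms(4))
  have error_le: "radial_error \<phi> \<xi>_opt \<eta>_opt t \<le> Y0\<^sup>2 / 108" if "t \<in> {-1..1}" for t
  proof -
    have "t\<^sup>2 \<le> 1"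
      using that by (simp add: abs_square_le_1 abs_le_iff)
    then have "Y0\<^sup>2 * (((1 - t\<^sup>2) / 4)\<^sup>2 * (1 - 4 * ((1 - t\<^sup>2) / 4))) \<le> Y0\<^sup>2 * (1 / 108)"
      by (intro mult_left_mono square_mult_one_minus_le) auto
    then show ?thesis
      by (simp add: error)
  qed
  have max_le: "max_error \<phi> \<xi>_opt \<eta>_opt \<le> Y0\<^sup>2 / 108"
  proof -
    obtain t where "t \<in> {-1..1}" "\<bar>radial_error \<phi> \<xi>_opt \<eta>_opt t\<bar> = max_error \<phi> \<xi>_opt \<eta>_opt"
      using max_error_attained[of \<phi> \<xi>_opt \<eta>_opt] by blast
    then show ?thesis
      using error_le[of t] error_nonneg[of t] by simp
  qed
  \<comment> \<open>Comparing with the explicit bound, rather than with another approximant, lets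
    this one claim yield both optimality and uniqueness.\<close>
  have unique: "\<xi> = \<xi>_opt \<and> \<eta> = \<eta>_opt"
    if outer': "outer_approximant \<phi> \<xi> \<eta>" and le: "max_error \<phi> \<xi> \<eta> \<le> Y0\<^sup>2 / 108" for \<xi> \<eta>
  proof -
    \<comment> \<open>This is the parameter \<open>t\<close> belonging to
      \<open>u = 1/6\<close>.\<close>
    have "sqrt (1 - 4 * (1 / 6)) \<in> {-1..1::real}"
      using real_sqrt_ge_zero[of "1/3 :: real"] by (simp del: real_sqrt_ge_0_iff)
    then have "radial_error \<phi> \<xi> \<eta> (sqrt (1 - 4 * (1 / 6))) \<le> max_error \<phi> \<xi> \<eta>"
      using max_error_attained[of \<phi> \<xi> \<eta>] abs_le_D1 by blast
    also note le
    finally have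
      "(c + 3 * (\<xi> - c) / 6)\<^sup>2 + (s + (3 * \<eta> - s) / 6)\<^sup>2 / 3 - 1 \<le> Y0\<^sup>2 / 108"
      by (subst (asm) radial_error_sqrt) (simp_all add: assms(3) s_def)
    moreover have "3 * (\<xi> - c) \<ge> 4 * (1 - c)"
      using outer_approximant_midpoint[OF outer'] \<open>0 \<le> c\<close> by (simp add: assms(3))
    moreover have "c * (3 * (\<xi> - c)) + s * (3 * \<eta> - s) \<ge> 2 * s\<^sup>2"
      using outer_approximant_endpoint[OF outer'] by (simp add: assms(3) s_def)
    ultimately have "3 * (\<xi> - c) = 4 * (1 - c) \<and> 3 * \<eta> - s = Y0"
      using cs \<open>0 \<le> c\<close> \<open>c < 1\<close> \<open>0 < s\<close> Y0 by (intro vertex_unique_minimizer) auto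
    then show ?thesis
      using X0 by (simp add: Y0_def)
  qed
  have optimal: "optimal_outer_approximant \<phi> \<xi>_opt \<eta>_opt"
    unfolding optimal_outer_approximant_def
  proof (intro conjI allI impI outer)
    fix \<xi> \<eta>
    assume outer': "outer_approximant \<phi> \<xi> \<eta>"
    show "max_error \<phi> \<xi>_opt \<eta>_opt \<le> max_error \<phi> \<xi> \<eta>"
    \<comment> \<open>Either the competitor is the vertex itself, or its error already exceeds the
      bound \<open>max_le\<close>.\<close>
    proof (cases "max_error \<phi> \<xi> \<eta> \<le> Y0\<^sup>2 / 108")
      case True
      then show ?thesis using unique[OF outer'] by simp
    next
      case False
      then show ?thesis using max_le by simp
    qed
  qed
  have "\<xi> = \<xi>_opt \<and> \<eta> = \<eta>_opt" if "optimal_outer_approximant \<phi> \<xi> \<eta>" for \<xi> \<eta>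
    using that outer max_le order_trans unfolding optimal_outer_approximant_def
    by (intro unique) blast+
  moreover have "G1_approximant \<phi> \<xi>_opt \<eta>_opt"
  proof -
    \<comment> \<open>The first coordinate of the tangency condition,
      \<open>r * s = \<xi>_opt - c\<close>, dictates this value.\<close>
    define r where "r = 4 * (1 - c) / (3 * s)"
    have "0 < r"
      using \<open>c < 1\<close> \<open>0 < s\<close> by (simp add: r_def)
    have rs: "r * s = \<xi>_opt - c"
      using \<open>0 < s\<close> X0 by (simp add: r_def)
    \<comment> \<open>Given \<open>r * s = \<xi>_opt - c\<close>, this is equality in the end point
      constraint \<open>c X + s Y \<ge> 2 s\<^sup>2\<close>: tangency means that this constraint is
      active.\<close>
    have "s * (r * c) = s * (s - \<eta>_opt)"
    proof -
      have "3 * (r * s) = 4 * (1 - c)"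
        using rs X0 by simp
      then have "3 * (s * (r * c)) = 3 * (s * (s - \<eta>_opt))"
        using \<eta> cs by algebra
      then show ?thesis by simp
    qed
    then have rc: "r * c = s - \<eta>_opt"
      using \<open>0 < s\<close> by simp
    have "control_point \<phi> \<xi>_opt \<eta>_opt 1 - control_point \<phi> \<xi>_opt \<eta>_opt 0
        = r *\<^sub>R vector [sin \<phi>, cos \<phi>]"
      using rs rc by (simp add: control_point_def vec_eq_iff forall_2 assms(3) s_def)
    moreover have "control_point \<phi> \<xi>_opt \<eta>_opt 3 - control_point \<phi> \<xi>_opt \<eta>_opt 2
        = r *\<^sub>R vector [- sin \<phi>, cos \<phi>]"
      using rs rc by (simp add: control_point_def vec_eq_iff forall_2 assms(3) s_def)
    ultimately show ?thesis
      using \<open>0 < r\<close> outer by (auto simp: G1_approximant_def outer_approximant_def)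
  qed
  ultimately show ?thesis
    using optimal by blast
qed

end
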